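(* For every $n\geq 0$, there is a $C_2$-equivariant immersion $\mathbb{P}(n\rho)\looparrowright 2^n\rho$.
   Context: $C_2$ is the cyclic group of order two, $\sigma$ its real sign representation, $\rho=1+\sigma$ its regular representation; $N\rho$ is the direct sum of $N$ copies of $\rho$. $\mathbb{P}(n\rho):=S(n\rho)/\text{antipodes}$ is the quotient of the unit sphere of $n\rho$ by the antipodal map, with its residual smooth $C_2$-action. A $C_2$-equivariant immersion is a smooth $C_2$-equivariant map whose differential is injective at each point. *)

theory Defs
  imports "HOL-Analysis.Analysis"
begin

text \<open>
  The dimensions here depend on a natural number \<open>n\<close>, so \<open>\<real>\<^sup>d\<close> is the carrier
  \<^term>\<open>topspace (Euclidean_space d)\<close>: functions \<open>nat \<Rightarrow> real\<close> vanishing at all indices \<open>\<ge> d\<close>.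
  Its topology is the subspace topology of \<open>nat \<Rightarrow> real\<close>, so \<^const>\<open>continuous_on\<close> on a
  subset of \<open>\<real>\<^sup>d\<close> has the usual meaning.
\<close>

abbreviation RR :: "nat \<Rightarrow> (nat \<Rightarrow> real) set"
  where "RR d \<equiv> topspace (Euclidean_space d)"

section \<open>Smooth maps and immersions\<close>

definition partial_deriv :: "nat \<Rightarrow> ((nat \<Rightarrow> real) \<Rightarrow> real) \<Rightarrow> (nat \<Rightarrow> real) \<Rightarrow> real"
  where "partial_deriv i g x = deriv (\<lambda>t. g (x(i := t))) (x i)"

text \<open>\<open>C\<^sup>k\<close> in the classical sense: all partial derivatives of order \<open>\<le> k\<close> exist and are continuous.\<close>

fun C_k_on :: "nat \<Rightarrow> nat \<Rightarrow> (nat \<Rightarrow> real) set \<Rightarrow> ((nat \<Rightarrow> real) \<Rightarrow> real) \<Rightarrow> bool" where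
  "C_k_on d 0 U g \<longleftrightarrow> continuous_on U g"
| "C_k_on d (Suc k) U g \<longleftrightarrow> continuous_on U g \<and>
     (\<forall>i<d. (\<forall>x\<in>U. (\<lambda>t. g (x(i := t))) field_differentiable at (x i)) \<and>
            C_k_on d k U (partial_deriv i g))"

definition smooth_on :: "nat \<Rightarrow> nat \<Rightarrow> (nat \<Rightarrow> real) set \<Rightarrow> ((nat \<Rightarrow> real) \<Rightarrow> nat \<Rightarrow> real) \<Rightarrow> bool"
  where "smooth_on d m U g \<longleftrightarrow>
    openin (Euclidean_space d) U \<and> g ` U \<subseteq> RR m \<and>
    (\<forall>j<m. \<forall>k. C_k_on d k U (\<lambda>x. g x j))"

text \<open>The linear map \<open>\<real>\<^sup>d \<rightarrow> \<real>\<^sup>m\<close> given by the Jacobian matrix of \<open>g\<close> at \<open>x\<close>.\<close>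

definition differential ::
    "nat \<Rightarrow> ((nat \<Rightarrow> real) \<Rightarrow> nat \<Rightarrow> real) \<Rightarrow> (nat \<Rightarrow> real) \<Rightarrow> (nat \<Rightarrow> real) \<Rightarrow> nat \<Rightarrow> real"
  where "differential d g x v = (\<lambda>j. \<Sum>i<d. partial_deriv i (\<lambda>z. g z j) x * v i)"

text \<open>
  An atlas of a \<open>d\<close>-dimensional manifold is given by its inverse charts: a pair \<open>(U, q)\<close> is an
  open subset \<open>U\<close> of \<open>\<real>\<^sup>d\<close> with a map \<open>q\<close> that sends \<open>U\<close> bijectively onto the coordinate domain.
\<close>

type_synonym 'p atlas = "((nat \<Rightarrow> real) set \<times> ((nat \<Rightarrow> real) \<Rightarrow> 'p)) set"

definition smooth_map :: "nat \<Rightarrow> 'p atlas \<Rightarrow> nat \<Rightarrow> ('p \<Rightarrow> nat \<Rightarrow> real) \<Rightarrow> bool"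
  where "smooth_map d A m f \<longleftrightarrow> (\<forall>(U, q)\<in>A. smooth_on d m U (f \<circ> q))"

definition immersion :: "nat \<Rightarrow> 'p atlas \<Rightarrow> nat \<Rightarrow> ('p \<Rightarrow> nat \<Rightarrow> real) \<Rightarrow> bool"
  where "immersion d A m f \<longleftrightarrow> smooth_map d A m f \<and>
    (\<forall>(U, q)\<in>A. \<forall>y\<in>U. inj_on (differential d (f \<circ> q) y) (RR d))"

section \<open>The representation \<open>N\<rho>\<close>\<close>

text \<open>
  \<open>N\<rho>\<close> is \<open>\<real>\<^sup>2\<^sup>N\<close>; the coordinates \<open>2i\<close> and \<open>2i + 1\<close> span the \<open>i\<close>-th copy of
  \<open>\<rho> = 1 + \<sigma>\<close>. The generator of \<open>C\<^sub>2\<close> acts by \<open>\<tau>\<close> (for every \<open>N\<close>), so a map is equivariant iff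
  it commutes with the generators.
\<close>

abbreviation rho :: "nat \<Rightarrow> (nat \<Rightarrow> real) set"
  where "rho N \<equiv> RR (2 * N)"

definition \<tau> :: "(nat \<Rightarrow> real) \<Rightarrow> (nat \<Rightarrow> real)"
  where "\<tau> x = (\<lambda>i. if even i then x i else - x i)"

definition equivariant :: "('p \<Rightarrow> 'p) \<Rightarrow> ('q \<Rightarrow> 'q) \<Rightarrow> 'p set \<Rightarrow> ('p \<Rightarrow> 'q) \<Rightarrow> bool"
  where "equivariant a b M f \<longleftrightarrow> (\<forall>p\<in>M. f (a p) = b (f p))"

section \<open>The projective space \<open>P(n\<rho>)\<close>\<close>

definition sphere_rho :: "nat \<Rightarrow> (nat \<Rightarrow> real) set"
  where "sphere_rho n = {x \<in> rho n. (\<Sum>i<2 * n. (x i)\<^sup>2) = 1}"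

definition antipodal :: "nat \<Rightarrow> ((nat \<Rightarrow> real) \<times> (nat \<Rightarrow> real)) set"
  where "antipodal n =
    {(x, y). x \<in> sphere_rho n \<and> y \<in> sphere_rho n \<and> (y = x \<or> y = (\<lambda>i. - x i))}"

definition proj_rho :: "nat \<Rightarrow> (nat \<Rightarrow> real) set set"
  where "proj_rho n = sphere_rho n // antipodal n"

text \<open>The residual action: the generator sends the class of \<open>x\<close> to the class of \<open>\<tau> x\<close>.\<close>

definition \<tau>_proj :: "(nat \<Rightarrow> real) set \<Rightarrow> (nat \<Rightarrow> real) set"
  where "\<tau>_proj p = \<tau> ` p"

text \<open>
  The sphere has the atlas of open hemispheres \<open>{x. s x\<^sub>i > 0}\<close>, \<open>s = \<plusminus>1\<close>, each
  parametrized over the open unit ball as a graph. A hemisphere contains no two antipodal points,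
  so composing with the quotient map gives the atlas of the quotient manifold.
\<close>

definition unit_ball :: "nat \<Rightarrow> (nat \<Rightarrow> real) set"
  where "unit_ball d = {y \<in> RR d. (\<Sum>i<d. (y i)\<^sup>2) < 1}"

definition hemisphere :: "nat \<Rightarrow> nat \<Rightarrow> real \<Rightarrow> (nat \<Rightarrow> real) \<Rightarrow> (nat \<Rightarrow> real)"
  where "hemisphere d i s y =
    (\<lambda>j. if j < i then y j else if j = i then s * sqrt (1 - (\<Sum>k<d. (y k)\<^sup>2)) else y (j - 1))"

text \<open>For \<open>n = 0\<close> the sphere is empty; then \<open>2 * n - 1\<close> truncates to \<open>0\<close>, and the atlases are empty.\<close>

definition sphere_atlas :: "nat \<Rightarrow> (nat \<Rightarrow> real) atlas"
  where "sphere_atlas n =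
    {(unit_ball (2 * n - 1), hemisphere (2 * n - 1) i s) | i s. i < 2 * n \<and> s \<in> {-1, 1}}"

definition proj_atlas :: "nat \<Rightarrow> (nat \<Rightarrow> real) set atlas"
  where "proj_atlas n = (\<lambda>(U, p). (U, \<lambda>y. antipodal n `` {p y})) ` sphere_atlas n"

definition C2_immersion :: "nat \<Rightarrow> nat \<Rightarrow> ((nat \<Rightarrow> real) set \<Rightarrow> nat \<Rightarrow> real) \<Rightarrow> bool"
  where "C2_immersion n N f \<longleftrightarrow>
    f ` proj_rho n \<subseteq> rho N \<and> equivariant \<tau>_proj \<tau> (proj_rho n) f \<and>
    immersion (2 * n - 1) (proj_atlas n) (2 * N) f"

section \<open>Adequacy: the charts are injective and cover; the residual action is well defined\<close>

lemma sum_remove_coord: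
  fixes g :: "nat \<Rightarrow> real"
  assumes "i \<le> d"
  shows "(\<Sum>k<Suc d. g k) = g i + (\<Sum>k<d. if k < i then g k else g (Suc k))"
  using assms
proof (induction d)
  case 0
  then show ?case by simp
next
  case (Suc d)
  show ?case
  proof (cases "i = Suc d")
    case True
    have "(\<Sum>k<Suc d. if k < i then g k else g (Suc k)) = (\<Sum>k<Suc d. g k)"
      by (rule sum.cong) (auto simp: True)
    then show ?thesis by (simp add: True)
  next
    case False
    then have "i \<le> d" using Suc.prems by simp
    then show ?thesis using Suc.IH by simp
  qed
qed

lemma hemisphere_in_sphere:
  assumes "i < 2 * n" "s \<in> {-1, 1}" "y \<in> unit_ball (2 * n - 1)"
  shows "hemisphere (2 * n - 1) i s y \<in> sphere_rho n"
proof -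
  obtain d where d: "2 * n = Suc d" using assms(1) by (cases "2 * n") auto
  have y: "\<And>k. k \<ge> d \<Longrightarrow> y k = 0" and l: "(\<Sum>k<d. (y k)\<^sup>2) < 1" and i: "i \<le> d"
    using assms by (auto simp: unit_ball_def topspace_Euclidean_space d)
  let ?h = "hemisphere d i s y"
  have "(\<Sum>k<Suc d. (?h k)\<^sup>2) = (?h i)\<^sup>2 + (\<Sum>k<d. if k < i then (?h k)\<^sup>2 else (?h (Suc k))\<^sup>2)"
    by (rule sum_remove_coord[OF i])
  also have "(\<Sum>k<d. if k < i then (?h k)\<^sup>2 else (?h (Suc k))\<^sup>2) = (\<Sum>k<d. (y k)\<^sup>2)"
    by (rule sum.cong) (auto simp: hemisphere_def)
  also have "(?h i)\<^sup>2 = 1 - (\<Sum>k<d. (y k)\<^sup>2)"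
    using l assms(2) by (auto simp: hemisphere_def power_mult_distrib)
  finally have "(\<Sum>k<Suc d. (?h k)\<^sup>2) = 1" by simp
  moreover have "?h \<in> RR (Suc d)"
    using y i by (auto simp: topspace_Euclidean_space hemisphere_def)
  ultimately show ?thesis
    unfolding sphere_rho_def d by simp
qed

lemma sphere_atlas_covers: "(\<Union>(U, p)\<in>sphere_atlas n. p ` U) = sphere_rho n"
proof
  show "(\<Union>(U, p)\<in>sphere_atlas n. p ` U) \<subseteq> sphere_rho n"
    using hemisphere_in_sphere by (fastforce simp: sphere_atlas_def)
  show "sphere_rho n \<subseteq> (\<Union>(U, p)\<in>sphere_atlas n. p ` U)"
  proof
    fix x assume x: "x \<in> sphere_rho n"
    then have "\<exists>i<2 * n. x i \<noteq> 0"
      unfolding sphere_rho_def by (auto intro: ccontr)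
    then obtain i where i: "i < 2 * n" "x i \<noteq> 0" by blast
    obtain d where d: "2 * n = Suc d" using i(1) by (cases "2 * n") auto
    define y where "y = (\<lambda>k. if k < i then x k else x (Suc k))"
    have x0: "\<And>k. k \<ge> Suc d \<Longrightarrow> x k = 0" and x1: "(\<Sum>k<Suc d. (x k)\<^sup>2) = 1"
      using x unfolding sphere_rho_def d by (auto simp: topspace_Euclidean_space)
    have "(\<Sum>k<Suc d. (x k)\<^sup>2) = (x i)\<^sup>2 + (\<Sum>k<d. if k < i then (x k)\<^sup>2 else (x (Suc k))\<^sup>2)"
      using i d by (intro sum_remove_coord) auto
    also have "(\<Sum>k<d. if k < i then (x k)\<^sup>2 else (x (Suc k))\<^sup>2) = (\<Sum>k<d. (y k)\<^sup>2)"
      by (rule sum.cong) (auto simp: y_def)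
    finally have s: "(x i)\<^sup>2 = 1 - (\<Sum>k<d. (y k)\<^sup>2)" using x1 by simp
    moreover have "(x i)\<^sup>2 > 0" using i by simp
    ultimately have ub: "y \<in> unit_ball d"
      using x0 i d by (auto simp: unit_ball_def topspace_Euclidean_space y_def)
    have "hemisphere d i (sgn (x i)) y = x"
    proof
      fix j
      have sq: "sgn (x i) * sqrt (1 - (\<Sum>k<d. (y k)\<^sup>2)) = x i"
        by (simp add: sgn_mult_abs flip: s)
      consider "j < i" | "j = i" | k where "j = Suc k" "i < j"
        using linorder_neqE_nat less_imp_Suc_add by blast
      then show "hemisphere d i (sgn (x i)) y j = x j"
      proof cases
        case 1
        then show ?thesis by (simp add: hemisphere_def y_def)
      next
        case 2
        show ?thesis unfolding 2 hemisphere_def using sq by simp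
      next
        case 3
        then show ?thesis by (simp add: hemisphere_def y_def)
      qed
    qed
    moreover have "(unit_ball d, hemisphere d i (sgn (x i))) \<in> sphere_atlas n"
      unfolding sphere_atlas_def using i d
      by (intro CollectI exI[of _ i] exI[of _ "sgn (x i)"]) (simp add: sgn_if)
    ultimately show "x \<in> (\<Union>(U, p)\<in>sphere_atlas n. p ` U)"
      using ub by (intro UN_I[of "(unit_ball d, hemisphere d i (sgn (x i)))"]) (simp_all add: rev_image_eqI)
  qed
qed

lemma proj_atlas_covers: "(\<Union>(U, q)\<in>proj_atlas n. q ` U) = proj_rho n"
proof -
  have "(\<Union>(U, q)\<in>proj_atlas n. q ` U) =
      (\<lambda>x. antipodal n `` {x}) ` (\<Union>(U, p)\<in>sphere_atlas n. p ` U)"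
    by (simp add: proj_atlas_def image_UN image_image case_prod_beta)
  then show ?thesis
    by (auto simp: sphere_atlas_covers proj_rho_def quotient_def)
qed

lemma proj_atlas_inj:
  assumes "(U, q) \<in> proj_atlas n"
  shows "inj_on q U"
proof (rule inj_onI)
  fix y z assume yz: "y \<in> U" "z \<in> U" "q y = q z"
  obtain i s where i: "i < 2 * n" "s \<in> {-1, 1}" and U: "U = unit_ball (2 * n - 1)"
    and q: "q = (\<lambda>y. antipodal n `` {hemisphere (2 * n - 1) i s y})"
    using assms by (auto simp: proj_atlas_def sphere_atlas_def)
  let ?h = "hemisphere (2 * n - 1) i s"
  have "?h y \<in> antipodal n `` {?h y}"
    using hemisphere_in_sphere[OF i] yz U by (simp add: antipodal_def)
  then have *: "?h y = ?h z \<or> ?h y = (\<lambda>j. - ?h z j)"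
    using yz(3) unfolding q by (auto simp: antipodal_def)
  have pos: "s * ?h w i > 0" if "w \<in> U" for w
    using that i U by (auto simp: hemisphere_def unit_ball_def)
  have "?h y = ?h z"
    using * pos[OF yz(1)] pos[OF yz(2)] by auto
  then have "?h y (if k < i then k else Suc k) = ?h z (if k < i then k else Suc k)" for k
    by simp
  moreover have h: "?h w (if k < i then k else Suc k) = w k" for w k
    by (simp add: hemisphere_def)
  ultimately have "y k = z k" for k
    unfolding h by blast
  then show "y = z" by blast
qed

lemma \<tau>_proj_class:
  assumes "x \<in> sphere_rho n"
  shows "\<tau>_proj (antipodal n `` {x}) = antipodal n `` {\<tau> x}" and "\<tau> x \<in> sphere_rho n"
proof -
  have sph: "\<tau> z \<in> sphere_rho n" "(\<lambda>i. - z i) \<in> sphere_rho n" if "z \<in> sphere_rho n" for z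
  proof -
    have "(\<Sum>i<2 * n. (\<tau> z i)\<^sup>2) = (\<Sum>i<2 * n. (z i)\<^sup>2)"
      by (rule sum.cong) (auto simp: \<tau>_def)
    then show "\<tau> z \<in> sphere_rho n" "(\<lambda>i. - z i) \<in> sphere_rho n"
      using that by (auto simp: sphere_rho_def topspace_Euclidean_space \<tau>_def)
  qed
  have cls: "antipodal n `` {z} = {z, \<lambda>i. - z i}" if "z \<in> sphere_rho n" for z
    using that sph(2)[OF that] by (auto simp: antipodal_def)
  have neg: "\<tau> (\<lambda>i. - x i) = (\<lambda>i. - \<tau> x i)"
    by (auto simp: \<tau>_def)
  show "\<tau>_proj (antipodal n `` {x}) = antipodal n `` {\<tau> x}"
    unfolding \<tau>_proj_def cls[OF assms] cls[OF sph(1)[OF assms]] by (simp add: neg)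
  show "\<tau> x \<in> sphere_rho n" by (rule sph(1)[OF assms])
qed

end

theory Submission
  imports Defs "HOL-Computational_Algebra.Formal_Power_Series"
begin

text \<open>
  Read a vector \<open>x\<close> of \<open>n\<rho>\<close> as the polynomial \<open>x(t) = \<Sum>\<^sub>i x\<^sub>i t\<^sup>i\<close> of degree less than \<open>2n\<close>. The
  immersion sends the class of \<open>x\<close> to the coefficients of \<open>x(t)\<^sup>2\<close>.

  The square does not change when \<open>x\<close> is replaced by \<open>- x\<close>, so the map is defined on
  \<open>P(n\<rho>)\<close>. Since the even coordinates of \<open>n\<rho>\<close> carry the trivial action and the odd ones the sign
  action, the generator acts on \<open>x(t)\<close> by the substitution \<open>t \<mapsto> - t\<close>, a ring homomorphism; so
  squaring is equivariant. The derivative of squaring at \<open>x\<close> in the direction \<open>v\<close> is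
  \<open>2 x(t) v(t)\<close>, which is nonzero for \<open>v \<noteq> 0\<close>, because \<open>x \<noteq> 0\<close> and a polynomial ring over a field has no
  zero divisors. It remains injective on the tangent spaces of the sphere, so the map is an immersion.
  Finally \<open>x(t)\<^sup>2\<close> has degree at most \<open>4n - 2\<close>, so the target can be taken to be \<open>2n\<rho>\<close>, and
  \<open>2n \<le> 2\<^sup>n\<close>.

  The charts are graphs of \<open>r(y) = sqrt (1 - \<bar>y\<bar>\<^sup>2)\<close> over the unit ball. Smoothness in these charts holds
  because the ring generated by the coordinates, \<open>r\<close> and \<open>1/r\<close> consists of continuous
  functions on the ball and is closed under partial derivatives.
\<close>

section \<open>Partial derivatives on open sets\<close>

lemma eventually_fun_upd_in_open:
  assumes "openin (Euclidean_space d) U" "x \<in> U" "i < d"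
  shows "\<forall>\<^sub>F t in nhds (x i). x(i := t) \<in> U"
proof -
  obtain T where T: "open T" "U = T \<inter> RR d"
    using assms(1) unfolding Euclidean_space_def openin_subtopology
    by (auto simp: topspace_Euclidean_space Euclidean_space_def euclidean_product_topology
        simp flip: open_openin)
  have "continuous_on UNIV (\<lambda>t. x(i := t))"
  proof (rule continuous_on_coordinatewise_then_product)
    show "continuous_on UNIV (\<lambda>t. (x(i := t)) j)" for j
      by (cases "j = i") auto
  qed
  then have "open ((\<lambda>t. x(i := t)) -` T)"
    using T(1) by (rule open_vimage[rotated])
  moreover have "x i \<in> (\<lambda>t. x(i := t)) -` T"
    using assms(2) T(2) by simp
  ultimately have "\<forall>\<^sub>F t in nhds (x i). x(i := t) \<in> T"
    by (auto simp: eventually_nhds)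
  moreover have "x(i := t) \<in> RR d" for t
    using assms(2,3) T(2) by (auto simp: topspace_Euclidean_space)
  ultimately show ?thesis
    by (simp add: T(2))
qed

lemma partial_deriv_cong:
  assumes "openin (Euclidean_space d) U" "x \<in> U" "i < d" "\<And>z. z \<in> U \<Longrightarrow> g z = g' z"
  shows "partial_deriv i g x = partial_deriv i g' x"
  unfolding partial_deriv_def
  by (rule deriv_cong_ev[OF eventually_mono[OF eventually_fun_upd_in_open[OF assms(1-3)]] refl])
    (rule assms(4))

lemma differential_cong:
  assumes "openin (Euclidean_space d) U" "x \<in> U" "\<And>z. z \<in> U \<Longrightarrow> g z = g' z"
  shows "differential d g x = differential d g' x"
  unfolding differential_def
  by (intro ext sum.cong refl arg_cong2[where f = "(*)"] partial_deriv_cong[OF assms(1,2)])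
    (auto simp: assms(3))

text \<open>
  The function \<open>h\<close> is only compared with a member of the family on \<open>U\<close>, because a partial
  derivative of a member agrees with another member on \<open>U\<close> only; this makes the induction on \<open>k\<close> work.
\<close>

lemma C_k_on_if_family_closed_under_derivatives:
  assumes U: "openin (Euclidean_space d) U"
    and cont: "\<And>g. S g \<Longrightarrow> continuous_on U g"
    and deriv: "\<And>g i. S g \<Longrightarrow> i < d \<Longrightarrow>
      \<exists>g'. S g' \<and> (\<forall>x\<in>U. ((\<lambda>t. g (x(i := t))) has_real_derivative g' x) (at (x i)))"
    and "S g" "\<And>x. x \<in> U \<Longrightarrow> h x = g x"
  shows "C_k_on d k U h"
  using assms(4,5)
proof (induction k arbitrary: g h)
  case 0
  then show ?case
    using cont by (simp cong: continuous_on_cong)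
next
  case (Suc k)
  have "(\<forall>x\<in>U. (\<lambda>t. h (x(i := t))) field_differentiable at (x i)) \<and> C_k_on d k U (partial_deriv i h)"
    if i: "i < d" for i
  proof -
    obtain g' where g': "S g'"
      "\<And>x. x \<in> U \<Longrightarrow> ((\<lambda>t. g (x(i := t))) has_real_derivative g' x) (at (x i))"
      using deriv[OF Suc.prems(1) i] by blast
    have h': "((\<lambda>t. h (x(i := t))) has_real_derivative g' x) (at (x i))" if "x \<in> U" for x
    proof -
      have "\<forall>\<^sub>F t in nhds (x i). h (x(i := t)) = g (x(i := t))"
        by (rule eventually_mono[OF eventually_fun_upd_in_open[OF U that i]]) (rule Suc.prems(2))
      then show ?thesis
        using g'(2)[OF that] by (simp add: DERIV_cong_ev[OF refl _ refl])
    qed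
    then have "partial_deriv i h x = g' x" if "x \<in> U" for x
      using that by (simp add: partial_deriv_def DERIV_imp_deriv)
    then show ?thesis
      using h' Suc.IH[OF g'(1)] by (auto simp: field_differentiable_def)
  qed
  then show ?case
    using Suc.prems cont by (simp cong: continuous_on_cong)
qed

section \<open>Smoothness in the hemisphere charts\<close>

definition height :: "nat \<Rightarrow> (nat \<Rightarrow> real) \<Rightarrow> real"
  where "height d y = sqrt (1 - (\<Sum>k<d. (y k)\<^sup>2))"

text \<open>
  The reciprocal of the height \<open>r\<close> is included since \<open>\<partial>\<^sub>i r = - y\<^sub>i / r\<close>; no further generators
  arise, as \<open>\<partial>\<^sub>i (1/r) = y\<^sub>i (1/r)\<^sup>3\<close>.
\<close>

inductive chart_function :: "nat \<Rightarrow> ((nat \<Rightarrow> real) \<Rightarrow> real) \<Rightarrow> bool" for d where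
  const: "chart_function d (\<lambda>y. c)"
| coord: "chart_function d (\<lambda>y. y j)"
| height: "chart_function d (height d)"
| inverse_height: "chart_function d (\<lambda>y. inverse (height d y))"
| add: "chart_function d f \<Longrightarrow> chart_function d g \<Longrightarrow> chart_function d (\<lambda>y. f y + g y)"
| mult: "chart_function d f \<Longrightarrow> chart_function d g \<Longrightarrow> chart_function d (\<lambda>y. f y * g y)"

lemma chart_function_sum:
  "(\<And>a. a \<in> A \<Longrightarrow> chart_function d (f a)) \<Longrightarrow> chart_function d (\<lambda>y. \<Sum>a\<in>A. f a y)"
  by (induction A rule: infinite_finite_induct) (auto intro: chart_function.intros)

lemma openin_unit_ball: "openin (Euclidean_space d) (unit_ball d)"
proof -
  have "open {y :: nat \<Rightarrow> real. (\<Sum>k<d. (y k)\<^sup>2) < 1}"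
    by (intro open_Collect_less continuous_intros continuous_on_product_coordinates)
  moreover have "unit_ball d = {y. (\<Sum>k<d. (y k)\<^sup>2) < 1} \<inter> RR d"
    by (auto simp: unit_ball_def)
  ultimately show ?thesis
    unfolding Euclidean_space_def openin_subtopology
    by (auto simp: euclidean_product_topology simp flip: open_openin)
qed

lemma height_pos: "y \<in> unit_ball d \<Longrightarrow> height d y > 0"
  by (simp add: height_def unit_ball_def)

lemma height_has_partial_derivative:
  assumes "y \<in> unit_ball d" "i < d"
  shows "((\<lambda>t. height d (y(i := t))) has_real_derivative - y i * inverse (height d y)) (at (y i))"
proof -
  define c where "c = 1 - (\<Sum>k\<in>{..<d} - {i}. (y k)\<^sup>2)"
  have sum: "1 - (\<Sum>k<d. ((y(i := t)) k)\<^sup>2) = c - t\<^sup>2" for t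
    using assms(2) by (subst sum.remove[of _ i]) (auto simp: c_def)
  have eq: "height d (y(i := t)) = sqrt (c - t\<^sup>2)" for t
    unfolding height_def sum ..
  have eq0: "height d y = sqrt (c - (y i)\<^sup>2)"
    using eq[of "y i"] by simp
  have "c - (y i)\<^sup>2 > 0"
    using height_pos[OF assms(1)] by (simp add: eq0)
  then show ?thesis
    unfolding eq eq0
    by (auto intro!: derivative_eq_intros simp: field_simps)
qed

lemma chart_function_continuous:
  assumes "chart_function d g"
  shows "continuous_on (unit_ball d) g"
  using assms
proof induction
  case height
  then show ?case
    unfolding height_def
    by (intro continuous_intros continuous_on_subset[OF continuous_on_product_coordinates subset_UNIV])
next
  case inverse_height
  have "height d y \<noteq> 0" if "y \<in> unit_ball d" for y
    using height_pos[OF that] by simp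
  moreover have "continuous_on (unit_ball d) (height d)"
    unfolding height_def
    by (intro continuous_intros continuous_on_subset[OF continuous_on_product_coordinates subset_UNIV])
  ultimately show ?case
    by (intro continuous_on_inverse) auto
qed (auto intro!: continuous_intros continuous_on_subset[OF continuous_on_product_coordinates subset_UNIV])

lemma chart_function_partial_derivative:
  assumes "chart_function d g" "i < d"
  shows "\<exists>g'. chart_function d g' \<and>
    (\<forall>y\<in>unit_ball d. ((\<lambda>t. g (y(i := t))) has_real_derivative g' y) (at (y i)))"
  using assms(1)
proof induction
  case (const c)
  then show ?case
    by (intro exI[of _ "\<lambda>y. 0"]) (auto intro: chart_function.const)
next
  case (coord j)
  then show ?case
    by (intro exI[of _ "\<lambda>y. if j = i then 1 else 0"]) (auto intro: chart_function.const)
next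
  case height
  have "chart_function d (\<lambda>y. (- 1 * y i) * inverse (height d y))"
    by (intro chart_function.intros)
  then have "chart_function d (\<lambda>y. - y i * inverse (height d y))"
    by simp
  then show ?case
    using height_has_partial_derivative[OF _ assms(2)]
    by blast
next
  case inverse_height
  have "chart_function d (\<lambda>y. y i * (inverse (height d y) * (inverse (height d y) * inverse (height d y))))"
    by (intro chart_function.intros)
  moreover have "((\<lambda>t. inverse (height d (y(i := t)))) has_real_derivative
      y i * (inverse (height d y) * (inverse (height d y) * inverse (height d y)))) (at (y i))"
    if "y \<in> unit_ball d" for y
    using height_pos[OF that]
    by (auto intro!: derivative_eq_intros height_has_partial_derivative[OF that assms(2)])
  ultimately show ?case by blast
next
  case (add f g)
  then obtain f' g' where *: "chart_function d f'" "chart_function d g'"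
    "\<And>y. y \<in> unit_ball d \<Longrightarrow> ((\<lambda>t. f (y(i := t))) has_real_derivative f' y) (at (y i))"
    "\<And>y. y \<in> unit_ball d \<Longrightarrow> ((\<lambda>t. g (y(i := t))) has_real_derivative g' y) (at (y i))"
    by blast
  have "chart_function d (\<lambda>y. f' y + g' y)"
    by (intro chart_function.add *)
  moreover have "((\<lambda>t. f (y(i := t)) + g (y(i := t))) has_real_derivative f' y + g' y) (at (y i))"
    if "y \<in> unit_ball d" for y
    by (rule DERIV_add[OF *(3)[OF that] *(4)[OF that]])
  ultimately show ?case by blast
next
  case (mult f g)
  then obtain f' g' where *: "chart_function d f'" "chart_function d g'"
    "\<And>y. y \<in> unit_ball d \<Longrightarrow> ((\<lambda>t. f (y(i := t))) has_real_derivative f' y) (at (y i))"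
    "\<And>y. y \<in> unit_ball d \<Longrightarrow> ((\<lambda>t. g (y(i := t))) has_real_derivative g' y) (at (y i))"
    by blast
  have "chart_function d (\<lambda>y. f' y * g y + g' y * f y)"
    by (intro chart_function.add chart_function.mult * mult.hyps)
  moreover have "((\<lambda>t. f (y(i := t)) * g (y(i := t))) has_real_derivative f' y * g y + g' y * f y)
      (at (y i))" if "y \<in> unit_ball d" for y
    using DERIV_mult[OF *(3)[OF that] *(4)[OF that]] by simp
  ultimately show ?case by blast
qed

lemma C_k_on_chart_function:
  assumes "chart_function d g" "\<And>y. y \<in> unit_ball d \<Longrightarrow> h y = g y"
  shows "C_k_on d k (unit_ball d) h"
  using C_k_on_if_family_closed_under_derivatives[where S = "chart_function d", OF openin_unit_ball
      chart_function_continuous chart_function_partial_derivative assms] .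

lemma chart_function_hemisphere: "chart_function d (\<lambda>y. hemisphere d i s y j)"
proof -
  have "chart_function d (\<lambda>y. if j < i then y j else if j = i then s * height d y else y (j - 1))"
    by (cases "j < i"; cases "j = i") (auto intro: chart_function.intros)
  then show ?thesis
    unfolding hemisphere_def height_def .
qed

section \<open>Injectivity of the differential of a hemisphere chart\<close>

text \<open>
  The coordinates other than \<open>i\<close> of a hemisphere chart are the coordinates of the ball. They alone
  make its differential injective, whatever the derivative of the height.
\<close>

lemma differential_hemisphere_coord:
  assumes "k < d"
  shows "differential d (hemisphere d i s) y v (if k < i then k else Suc k) = v k"
proof -
  have "partial_deriv a (\<lambda>z. hemisphere d i s z (if k < i then k else Suc k)) y = (if a = k then 1 else 0)"
    for a
    by (auto simp: partial_deriv_def hemisphere_def)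
  then have "differential d (hemisphere d i s) y v (if k < i then k else Suc k)
      = (\<Sum>a<d. if a = k then v a else 0)"
    unfolding differential_def by (intro sum.cong) auto
  then show ?thesis
    using assms by (simp add: sum.delta)
qed

lemma inj_on_differential_hemisphere: "inj_on (differential d (hemisphere d i s) y) (RR d)"
proof (rule inj_onI)
  fix v w
  assume vw: "v \<in> RR d" "w \<in> RR d"
    and eq: "differential d (hemisphere d i s) y v = differential d (hemisphere d i s) y w"
  show "v = w"
  proof
    fix k
    show "v k = w k"
    proof (cases "k < d")
      case True
      then show ?thesis
        using differential_hemisphere_coord[OF True] eq by metis
    next
      case False
      then show ?thesis
        using vw by (simp add: topspace_Euclidean_space)
    qed
  qed
qed

section \<open>Squaring of polynomials\<close>

text \<open>
  Vectors are read as power series, so that no degree has to be fixed; power series over a field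
  form an integral domain as well.
\<close>

definition square_coeffs :: "(nat \<Rightarrow> real) \<Rightarrow> nat \<Rightarrow> real"
  where "square_coeffs x = fps_nth ((Abs_fps x)\<^sup>2)"

lemma square_coeffs_eq_sum: "square_coeffs x k = (\<Sum>a=0..k. x a * x (k - a))"
  by (simp add: square_coeffs_def power2_eq_square fps_mult_nth)

lemma square_coeffs_minus: "square_coeffs (\<lambda>i. - x i) = square_coeffs x"
  by (auto simp: square_coeffs_eq_sum)

lemma square_coeffs_\<tau>: "square_coeffs (\<tau> x) = \<tau> (square_coeffs x)"
proof
  fix k
  have "\<tau> x a * \<tau> x (k - a) = (if even k then 1 else - 1) * (x a * x (k - a))" if "a \<le> k" for a
    using that by (auto simp: \<tau>_def)
  then have "square_coeffs (\<tau> x) k = (\<Sum>a=0..k. (if even k then 1 else - 1) * (x a * x (k - a)))"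
    by (simp add: square_coeffs_eq_sum)
  then show "square_coeffs (\<tau> x) k = \<tau> (square_coeffs x) k"
    by (simp add: square_coeffs_eq_sum \<tau>_def flip: sum_distrib_left)
qed

lemma square_coeffs_in_RR:
  assumes "x \<in> RR d" "2 * d \<le> m"
  shows "square_coeffs x \<in> RR m"
proof -
  have "x a * x (k - a) = 0" if "k \<ge> m" for a k
  proof (cases "a < d")
    case True
    then have "k - a \<ge> d"
      using that assms(2) by simp
    then show ?thesis
      using assms(1) by (simp add: topspace_Euclidean_space)
  next
    case False
    then show ?thesis
      using assms(1) by (simp add: topspace_Euclidean_space)
  qed
  then show ?thesis
    unfolding topspace_Euclidean_space square_coeffs_eq_sum by (simp add: sum.neutral del: mult_eq_0_iff)
qed

text \<open>
  The chain rule in this form reduces injectivity of the differential to the cancellation of the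
  factor \<open>2 h(y)\<close>. The two halves of the product rule for \<open>\<Sum>\<^sub>a h\<^sub>a h\<^bsub>k-a\<^esub>\<close> agree by the
  substitution \<open>a \<mapsto> k - a\<close>.
\<close>

lemma differential_square_coeffs:
  assumes "\<And>i k. i < d \<Longrightarrow> (\<lambda>t. h (y(i := t)) k) field_differentiable at (y i)"
  shows "Abs_fps (differential d (square_coeffs \<circ> h) y v) =
    fps_const 2 * Abs_fps (h y) * Abs_fps (differential d h y v)"
proof (rule fps_ext)
  fix k
  have pd: "partial_deriv i (\<lambda>z. square_coeffs (h z) k) y =
      2 * (\<Sum>a=0..k. h y a * partial_deriv i (\<lambda>z. h z (k - a)) y)" if i: "i < d" for i
  proof -
    define D where "D c = partial_deriv i (\<lambda>z. h z c) y" for c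
    have D: "((\<lambda>t. h (y(i := t)) c) has_real_derivative D c) (at (y i))" for c
      using assms[OF i, of c] by (simp add: D_def partial_deriv_def DERIV_deriv_iff_field_differentiable)
    have "((\<lambda>t. \<Sum>a=0..k. h (y(i := t)) a * h (y(i := t)) (k - a)) has_real_derivative
        (\<Sum>a=0..k. D a * h y (k - a) + D (k - a) * h y a)) (at (y i))"
      by (rule DERIV_sum) (use DERIV_mult[OF D D] in simp)
    then have "partial_deriv i (\<lambda>z. square_coeffs (h z) k) y =
        (\<Sum>a=0..k. D a * h y (k - a) + D (k - a) * h y a)"
      unfolding partial_deriv_def square_coeffs_eq_sum by (rule DERIV_imp_deriv)
    also have "\<dots> = (\<Sum>a=0..k. D a * h y (k - a)) + (\<Sum>a=0..k. D (k - a) * h y a)"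
      by (rule sum.distrib)
    also have "(\<Sum>a=0..k. D a * h y (k - a)) = (\<Sum>a=0..k. D (k - a) * h y a)"
      by (subst sum.atLeastAtMost_rev) simp
    finally show ?thesis
      by (simp add: D_def mult.commute)
  qed
  have "differential d (square_coeffs \<circ> h) y v k =
      (\<Sum>i<d. 2 * (\<Sum>a=0..k. h y a * partial_deriv i (\<lambda>z. h z (k - a)) y) * v i)"
    by (simp add: differential_def pd)
  also have "\<dots> = 2 * (\<Sum>i<d. \<Sum>a=0..k. h y a * (partial_deriv i (\<lambda>z. h z (k - a)) y * v i))"
    by (simp add: sum_distrib_left sum_distrib_right mult.assoc)
  also have "(\<Sum>i<d. \<Sum>a=0..k. h y a * (partial_deriv i (\<lambda>z. h z (k - a)) y * v i)) =
      (\<Sum>a=0..k. h y a * differential d h y v (k - a))"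
    by (subst sum.swap) (simp add: differential_def sum_distrib_left)
  also have "2 * \<dots> = fps_nth (fps_const 2 * Abs_fps (h y) * Abs_fps (differential d h y v)) k"
    by (simp add: mult.assoc fps_mult_nth[of "Abs_fps (h y)"])
  finally show "fps_nth (Abs_fps (differential d (square_coeffs \<circ> h) y v)) k =
      fps_nth (fps_const 2 * Abs_fps (h y) * Abs_fps (differential d h y v)) k"
    by (simp add: comp_def)
qed

lemma inj_on_differential_square_coeffs:
  assumes "\<And>i k. i < d \<Longrightarrow> (\<lambda>t. h (y(i := t)) k) field_differentiable at (y i)"
    and "h y \<noteq> (\<lambda>k. 0)" and inj: "inj_on (differential d h y) V"
  shows "inj_on (differential d (square_coeffs \<circ> h) y) V"
proof (rule inj_onI)
  fix v w
  assume vw: "v \<in> V" "w \<in> V"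
    and "differential d (square_coeffs \<circ> h) y v = differential d (square_coeffs \<circ> h) y w"
  then have "fps_const 2 * Abs_fps (h y) * Abs_fps (differential d h y v) =
      fps_const 2 * Abs_fps (h y) * Abs_fps (differential d h y w)"
    using differential_square_coeffs[of d h y, OF assms(1)] by metis
  moreover have "fps_const 2 * Abs_fps (h y) \<noteq> 0"
    using assms(2) by (auto simp: fps_eq_iff[of "Abs_fps (h y)"])
  ultimately have "Abs_fps (differential d h y v) = Abs_fps (differential d h y w)"
    by simp
  then have "differential d h y v = differential d h y w"
    by (metis fps_nth_Abs_fps ext)
  then show "v = w"
    using inj vw by (blast dest: inj_onD)
qed

section \<open>The immersion of the projective space\<close>

definition proj_square :: "(nat \<Rightarrow> real) set \<Rightarrow> nat \<Rightarrow> real"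
  where "proj_square p = square_coeffs (SOME x. x \<in> p)"

lemma proj_square_class:
  assumes "x \<in> sphere_rho n"
  shows "proj_square (antipodal n `` {x}) = square_coeffs x"
proof -
  have "x \<in> antipodal n `` {x}"
    using assms by (simp add: antipodal_def)
  then have "(SOME z. z \<in> antipodal n `` {x}) \<in> antipodal n `` {x}"
    by (rule someI[where P = "\<lambda>z. z \<in> antipodal n `` {x}"])
  then have "(SOME z. z \<in> antipodal n `` {x}) \<in> {x, \<lambda>i. - x i}"
    by (auto simp: antipodal_def)
  then show ?thesis
    unfolding proj_square_def using square_coeffs_minus[of x] by (metis insertE singletonD)
qed

lemma square_coeffs_sphere_in_rho:
  assumes "x \<in> sphere_rho n"
  shows "square_coeffs x \<in> rho (2 ^ n)"
proof (rule square_coeffs_in_RR)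
  show "x \<in> RR (2 * n)"
    using assms by (simp add: sphere_rho_def)
  have "2 * n \<le> 2 ^ n"
  proof (cases n)
    case (Suc m)
    then show ?thesis
      using less_exp[of m] by (simp add: Suc_le_eq flip: mult_Suc_right)
  qed simp
  then show "2 * (2 * n) \<le> 2 * 2 ^ n"
    by simp
qed

lemma sphere_rho_nonzero: "x \<in> sphere_rho n \<Longrightarrow> x \<noteq> (\<lambda>k. 0)"
  by (auto simp: sphere_rho_def)

lemma proj_square_chart:
  assumes "i < 2 * n" "s \<in> {-1, 1}"
  defines "h \<equiv> hemisphere (2 * n - 1) i s" and "q \<equiv> \<lambda>y. antipodal n `` {hemisphere (2 * n - 1) i s y}"
  shows "smooth_on (2 * n - 1) (2 * 2 ^ n) (unit_ball (2 * n - 1)) (proj_square \<circ> q)"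
    and "y \<in> unit_ball (2 * n - 1) \<Longrightarrow>
      inj_on (differential (2 * n - 1) (proj_square \<circ> q) y) (RR (2 * n - 1))"
proof -
  let ?d = "2 * n - 1"
  have sph: "h y \<in> sphere_rho n" if "y \<in> unit_ball ?d" for y
    unfolding h_def by (rule hemisphere_in_sphere[OF assms(1,2) that])
  have eq: "(proj_square \<circ> q) y = (square_coeffs \<circ> h) y" if "y \<in> unit_ball ?d" for y
    using proj_square_class[OF sph[OF that]] by (simp add: q_def h_def)
  have "chart_function ?d (\<lambda>y. square_coeffs (h y) k)" for k
    unfolding square_coeffs_eq_sum h_def
    by (intro chart_function_sum chart_function.mult chart_function_hemisphere)
  then have "C_k_on ?d k (unit_ball ?d) (\<lambda>y. (proj_square \<circ> q) y j)" for k j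
    using eq by (intro C_k_on_chart_function) auto
  then show "smooth_on ?d (2 * 2 ^ n) (unit_ball ?d) (proj_square \<circ> q)"
    using openin_unit_ball eq square_coeffs_sphere_in_rho[OF sph] by (auto simp: smooth_on_def)
  assume y: "y \<in> unit_ball ?d"
  have "(\<lambda>t. h (y(a := t)) k) field_differentiable at (y a)" if "a < ?d" for a k
    using chart_function_partial_derivative[OF chart_function_hemisphere that] y
    unfolding h_def field_differentiable_def by blast
  then have "inj_on (differential ?d (square_coeffs \<circ> h) y) (RR ?d)"
    using sphere_rho_nonzero[OF sph[OF y]] inj_on_differential_hemisphere
    unfolding h_def by (intro inj_on_differential_square_coeffs) auto
  then show "inj_on (differential ?d (proj_square \<circ> q) y) (RR ?d)"
    by (subst differential_cong[OF openin_unit_ball y eq])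
qed

theorem corollary4p20:
  fixes n :: nat
  shows "\<exists>f. C2_immersion n (2 ^ n) f"
proof (rule exI[of _ proj_square])
  have "immersion (2 * n - 1) (proj_atlas n) (2 * 2 ^ n) proj_square"
    using proj_square_chart
    by (fastforce simp: immersion_def smooth_map_def proj_atlas_def sphere_atlas_def)
  moreover have "proj_square ` proj_rho n \<subseteq> rho (2 ^ n)"
    using square_coeffs_sphere_in_rho
    by (auto simp: proj_rho_def proj_square_class elim!: quotientE)
  moreover have "equivariant \<tau>_proj \<tau> (proj_rho n) proj_square"
    by (auto simp: equivariant_def proj_rho_def \<tau>_proj_class proj_square_class square_coeffs_\<tau>
        elim!: quotientE)
  ultimately show "C2_immersion n (2 ^ n) proj_square"
    by (simp add: C2_immersion_def)
qed

end
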